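(* There exists an infinite family of cop-win directed graphs whose capture time is quadratic in the number of vertices: there are constants $0 < a \le b$ and directed graphs $D$ with arbitrarily large number of vertices $n$ such that $c(D) = 1$ and $a n^2 \le \mathrm{capt}(D) \le b n^2$ for every $D$ in the family.
   Context: All graphs are finite. Game of cops and robbers with $k$ cops on a digraph: first each of the $k$ cops chooses a starting vertex (several cops may share a vertex), then the robber chooses a starting vertex. The game proceeds in rounds: in each round every cop either stays in place or moves along an arc (from its tail to its head), after which the robber either stays in place or moves along an arc. All positions are known to everyone. The cops win if after finitely many rounds some cop occupies the same vertex as the robber; the robber wins if he avoids this forever. The cop number $c(D)$ is the least $k$ for which $k$ cops have a winning strategy; $D$ is cop-win if $c(D)=1$. The capture time $\mathrm{capt}(D)$ is the fewest number of rounds in which $c(D)$ cops can guarantee to win. *)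

theory Defs
  imports Complex_Main "Graph_Theory.Digraph"
begin

definition move :: "('a, 'b) pre_digraph \<Rightarrow> 'a \<Rightarrow> 'a \<Rightarrow> bool" where
  "move D u v \<longleftrightarrow> u = v \<or> u \<rightarrow>\<^bsub>D\<^esub> v"

text \<open>
  The robber's play: \<open>r 0\<close> is the starting vertex and \<open>r t\<close> the position at the
  end of round \<open>t\<close> (rounds are numbered from 1). Plays are continued for ever;
  since staying in place is legal, what happens after a capture is irrelevant.
\<close>
definition robber_play :: "('a, 'b) pre_digraph \<Rightarrow> (nat \<Rightarrow> 'a) \<Rightarrow> bool" where
  "robber_play D r \<longleftrightarrow> r 0 \<in> verts D \<and> (\<forall>t. move D (r t) (r (Suc t)))"

text \<open>
  A strategy of the cops maps the list of the robber's positions so far to the list of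
  positions of the cops: \<open>S []\<close> is the initial placement, and \<open>S [r 0, \<dots>, r (t - 1)]\<close>
  is the position after the cops' move of round \<open>t\<close>. The cops' own earlier positions
  are determined by the strategy and so need not be an argument.
\<close>
definition cop_strategy :: "('a, 'b) pre_digraph \<Rightarrow> nat \<Rightarrow> ('a list \<Rightarrow> 'a list) \<Rightarrow> bool" where
  "cop_strategy D k S \<longleftrightarrow>
     length (S []) = k \<and> set (S []) \<subseteq> verts D \<and>
     (\<forall>r. robber_play D r \<longrightarrow>
        (\<forall>t. list_all2 (move D) (S (map r [0..<t])) (S (map r [0..<Suc t]))))"

text \<open>
  The robber shares a vertex with a cop at some moment of round \<open>t\<close>: either at its end,
  or between the cops' move and the robber's move. For \<open>t = 0\<close> this
  refers to the initial placement.
\<close>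
definition captured_at :: "('a list \<Rightarrow> 'a list) \<Rightarrow> (nat \<Rightarrow> 'a) \<Rightarrow> nat \<Rightarrow> bool" where
  "captured_at S r t \<longleftrightarrow>
     r t \<in> set (S (map r [0..<t])) \<or> (t > 0 \<and> r (t - 1) \<in> set (S (map r [0..<t])))"

definition cops_win :: "('a, 'b) pre_digraph \<Rightarrow> nat \<Rightarrow> bool" where
  "cops_win D k \<longleftrightarrow>
     (\<exists>S. cop_strategy D k S \<and> (\<forall>r. robber_play D r \<longrightarrow> (\<exists>t. captured_at S r t)))"

definition cops_win_within :: "('a, 'b) pre_digraph \<Rightarrow> nat \<Rightarrow> nat \<Rightarrow> bool" where
  "cops_win_within D k m \<longleftrightarrow>
     (\<exists>S. cop_strategy D k S \<and> (\<forall>r. robber_play D r \<longrightarrow> (\<exists>t\<le>m. captured_at S r t)))"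

text \<open>
  On a finite digraph both minima below range over nonempty sets: one cop on each vertex
  wins at once, and, as the robber has finitely many choices in each round, a winning
  strategy of the cops wins within a bounded number of rounds (Koenig's lemma).
\<close>
definition cop_number :: "('a, 'b) pre_digraph \<Rightarrow> nat" where
  "cop_number D = (LEAST k. cops_win D k)"

definition capture_time :: "('a, 'b) pre_digraph \<Rightarrow> nat" where
  "capture_time D = (LEAST m. cops_win_within D (cop_number D) m)"

end

theory Submission
  imports Defs "HOL-Library.Countable"
begin

text \<open>
  The digraph consists of a two-way corridor \<open>0, \<dots>, N\<close>, a one-way trail \<open>0, \<dots>, N\<close> and
  a directed triangle. The end \<open>0\<close> of the corridor dominates the even trail vertices, the end
  \<open>N\<close> the odd ones, and every corridor vertex dominates the triangle. A robber on the
  trail advances by one vertex only when the cop reaches the end that threatens him, and is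
  then threatened from the opposite end: the cop must traverse the corridor about \<open>N\<close> times.
  Leaving the corridor is fatal for the cop, since he cannot return to it: each trail vertex has
  an exit to the triangle that its predecessor on the trail does not dominate, and on the
  triangle the robber is never caught.
\<close>

section \<open>Certificates for one cop\<close>

text \<open>\<open>J n x r\<close> is a countdown: with the cop at \<open>x\<close> to move and the
  robber at \<open>r\<close>, capture is due within \<open>n\<close> rounds. Since
  \<open>J 0\<close> is impossible, a countdown from \<open>B\<close> cannot run out without a
  capture.\<close>

lemma cops_win_within_oneI:
  assumes start: "start \<in> verts D"
    and init: "\<And>r. r \<in> verts D \<Longrightarrow> r = start \<or> J B start r"
    and zero: "\<And>x r. \<not> J 0 x r"
    and step: "\<And>n x r. J (Suc n) x r \<Longrightarrow>
      \<exists>x'. move D x x' \<and> (x' = r \<or> (\<forall>r'. move D r r' \<longrightarrow> r' = x' \<or> J n x' r'))"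
  shows "cops_win_within D 1 B"
proof -
  define good where "good n x r x' \<longleftrightarrow> move D x x' \<and>
    (x' = r \<or> (\<forall>r'. move D r r' \<longrightarrow> r' = x' \<or> J (n - 1) x' r'))" for n x r x'
  \<comment> \<open>The default \<open>x\<close> keeps the cop in place, so his moves are legal on
    every history, as \<open>cop_strategy\<close> demands.\<close>
  define f where "f n x r = (if \<exists>x'. good n x r x' then SOME x'. good n x r x' else x)" for n x r
  have f_good: "good (Suc n) x r (f (Suc n) x r)" if "J (Suc n) x r" for n x r
  proof -
    have ex: "\<exists>x'. good (Suc n) x r x'" using step[OF that] by (simp add: good_def)
    then show ?thesis using someI_ex[OF ex] by (simp add: f_def)
  qed
  have f_move: "move D x (f n x r)" for n x r
  proof (cases "\<exists>x'. good n x r x'")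
    case True
    then have "good n x r (f n x r)" using someI_ex[OF True] by (simp add: f_def)
    then show ?thesis by (simp add: good_def)
  qed (simp add: f_def move_def)
  \<comment> \<open>A strategy sees only the robber's history, so the remaining rounds and the cop's
    own position are recomputed by folding over it.\<close>
  define st where "st = foldl (\<lambda>(n, x) r. (n - 1 :: nat, f n x r)) (B, start)"
  define S where "S h = [snd (st h)]" for h
  have st_snoc: "st (h @ [r]) = (fst (st h) - 1, f (fst (st h)) (snd (st h)) r)" for h r
    by (simp add: st_def case_prod_beta)
  have "cop_strategy D 1 S"
    using start f_move by (simp add: cop_strategy_def S_def st_snoc) (simp add: st_def)
  moreover have "\<exists>t\<le>B. captured_at S r t" if play: "robber_play D r" for r
  proof (rule ccontr)
    assume free: "\<not> (\<exists>t\<le>B. captured_at S r t)"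
    have fst_st: "fst (st (map r [0..<t])) = B - t" for t
      by (induction t) (simp_all add: st_snoc, simp add: st_def)
    have "J (B - t) (snd (st (map r [0..<t]))) (r t)" if "t \<le> B" for t
      using that
    proof (induction t)
      case 0
      have "r 0 \<noteq> start" using free by (auto simp: captured_at_def S_def st_def)
      then show ?case using init[of "r 0"] play by (auto simp: robber_play_def st_def)
    next
      case (Suc t)
      let ?x = "snd (st (map r [0..<t]))"
      obtain n where n: "B - t = Suc n" "n = B - Suc t"
        using Suc.prems by (metis Suc_diff_Suc Suc_le_lessD)
      define x' where "x' = snd (st (map r [0..<Suc t]))"
      have x': "x' = f (Suc n) ?x (r t)"
        by (simp add: x'_def st_snoc fst_st n(1))
      have "good (Suc n) ?x (r t) x'"
        unfolding x' using Suc n(1) by (intro f_good) simp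
      moreover have "\<not> captured_at S r (Suc t)" using free Suc.prems by blast
      then have "x' \<noteq> r t" "x' \<noteq> r (Suc t)"
        unfolding captured_at_def S_def x'_def by auto
      moreover have "move D (r t) (r (Suc t))" using play by (simp add: robber_play_def)
      ultimately show ?case
        unfolding n(2)[symmetric] x'_def[symmetric] good_def diff_Suc_1 by blast
    qed
    from this[of B] zero show False by simp
  qed
  ultimately show ?thesis unfolding cops_win_within_def by blast
qed

text \<open>Dual certificate: under \<open>I n x r\<close> the robber can hold out for
  \<open>n\<close> more rounds. Against a fixed \<open>S\<close> his answers are chosen round by
  round.\<close>

lemma not_cops_win_within_oneI:
  assumes init: "\<And>x. x \<in> verts D \<Longrightarrow> \<exists>r\<in>verts D. I T x r"
    and apart: "\<And>n x r. I n x r \<Longrightarrow> x \<noteq> r"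
    and step: "\<And>n x x' r. I (Suc n) x r \<Longrightarrow> move D x x' \<Longrightarrow>
      x' \<noteq> r \<and> (\<exists>r'. move D r r' \<and> I n x' r')"
  shows "\<not> cops_win_within D 1 T"
proof
  assume "cops_win_within D 1 T"
  then obtain S where S: "cop_strategy D 1 S"
    and win: "\<And>r. robber_play D r \<Longrightarrow> \<exists>t\<le>T. captured_at S r t"
    unfolding cops_win_within_def by blast
  obtain x0 where x0: "S [] = [x0]" "x0 \<in> verts D"
    using S by (auto simp: cop_strategy_def length_Suc_conv)
  obtain r0 where r0: "r0 \<in> verts D" "I T x0 r0" using init x0 by blast
  define g where "g n x' r = (if \<exists>r'. move D r r' \<and> I n x' r'
    then SOME r'. move D r r' \<and> I n x' r' else r)" for n x' r
  have g_move: "move D r (g n x' r)" for n x' r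
  proof (cases "\<exists>r'. move D r r' \<and> I n x' r'")
    case True
    then show ?thesis using someI_ex[OF True] by (simp add: g_def)
  next
    case False
    then have "g n x' r = r" unfolding g_def by (rule if_not_P)
    then show ?thesis by (simp add: move_def)
  qed
  have g_I: "I n x' (g n x' r)" if "\<exists>r'. move D r r' \<and> I n x' r'" for n x' r
    using someI_ex[OF that] that by (simp add: g_def)
  \<comment> \<open>\<open>S\<close> reads whole histories, so the recursion builds the history
    itself. \<open>h t\<close> has \<open>t + 1\<close> entries, hence \<open>S (h t)\<close> is the
    placement after the cop's move of round \<open>t + 1\<close>.\<close>
  define h where "h = rec_nat [r0] (\<lambda>t h. h @ [g (T - Suc t) (hd (S h)) (last h)])"
  define r where "r t = last (h t)" for t
  have h_0: "h 0 = [r0]" and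
    h_Suc: "h (Suc t) = h t @ [g (T - Suc t) (hd (S (h t))) (r t)]" for t
    by (simp_all add: h_def r_def)
  have map_r: "map r [0..<Suc t] = h t" for t
    by (induction t) (simp_all add: h_0 h_Suc r_def)
  define x where "x t = hd (S (map r [0..<t]))" for t
  have r_Suc: "r (Suc t) = g (T - Suc t) (x (Suc t)) (r t)" for t
    unfolding x_def map_r by (simp add: r_def h_Suc)
  have play: "robber_play D r"
    using r0 g_move by (simp add: robber_play_def r_Suc) (simp add: r_def h_0)
  have moves: "list_all2 (move D) (S (map r [0..<t])) (S (map r [0..<Suc t]))" for t
    using S play unfolding cop_strategy_def by blast
  have len: "length (S (map r [0..<t])) = 1" for t
  proof (induction t)
    case (Suc t)
    then show ?case using list_all2_lengthD[OF moves[of t]] by simp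
  qed (simp add: x0)
  have Sx: "S (map r [0..<t]) = [x t]" for t
    using len[of t] unfolding x_def by (auto simp: length_Suc_conv)
  have x_move: "move D (x t) (x (Suc t))" for t
    using moves[of t] unfolding Sx by simp
  have I_t: "I (T - t) (x t) (r t)" if "t \<le> T" for t
    using that
  proof (induction t)
    case 0
    then show ?case using r0 x0 by (simp add: x_def r_def h_0)
  next
    case (Suc t)
    then have "I (Suc (T - Suc t)) (x t) (r t)" by (simp add: Suc_diff_Suc)
    from step[OF this x_move] show ?case unfolding r_Suc by (intro g_I) blast
  qed
  obtain t where t: "t \<le> T" "captured_at S r t" using win[OF play] by blast
  have "r t \<noteq> x t" using I_t[OF t(1)] apart by metis
  \<comment> \<open>The other half of \<open>captured_at\<close>: the cop stepping onto the robber
    before he answers, excluded by \<open>step\<close> for the preceding position.\<close>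
  moreover have "r (t - 1) \<noteq> x t" if pos: "t > 0"
  proof -
    obtain s where s: "t = Suc s" using pos by (cases t) auto
    with t I_t[of s] have "I (Suc (T - Suc s)) (x s) (r s)" by (simp add: Suc_diff_Suc)
    from step[OF this x_move] have "x t \<noteq> r s" unfolding s by blast
    then show ?thesis using s by simp
  qed
  ultimately show False using t(2) unfolding captured_at_def Sx by auto
qed

lemma not_cops_win_zero:
  assumes "verts D \<noteq> {}"
  shows "\<not> cops_win D 0"
proof
  assume "cops_win D 0"
  then obtain S where S: "cop_strategy D 0 S"
    and win: "\<And>r. robber_play D r \<Longrightarrow> \<exists>t. captured_at S r t"
    unfolding cops_win_def by blast
  obtain v where v: "v \<in> verts D" using assms by blast
  let ?r = "\<lambda>_::nat. v"
  have play: "robber_play D ?r" using v by (simp add: robber_play_def move_def)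
  have "S (map ?r [0..<t]) = []" for t
  proof (induction t)
    case 0
    then show ?case using S by (simp add: cop_strategy_def)
  next
    case (Suc t)
    have "list_all2 (move D) (S (map ?r [0..<t])) (S (map ?r [0..<Suc t]))"
      using S play unfolding cop_strategy_def by blast
    then show ?case unfolding Suc.IH by simp
  qed
  with win[OF play] show False unfolding captured_at_def by auto
qed

section \<open>The digraphs\<close>

datatype node = Corridor nat | Trail nat | Ring nat

instance node :: countable
  by countable_datatype

text \<open>The distance from the corridor vertex \<open>a\<close> to the end that dominates the trail vertex \<open>i\<close>.\<close>
definition gap :: "nat \<Rightarrow> nat \<Rightarrow> nat \<Rightarrow> nat" where
  "gap N i a = (if even i then a else N - a)"

text \<open>The label \<open>i mod 2\<close> gives consecutive trail vertices different exits and
  leaves \<open>Ring 2\<close> without arcs from the trail.\<close>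

fun edge :: "nat \<Rightarrow> node \<Rightarrow> node \<Rightarrow> bool" where
  "edge N (Corridor a) (Corridor b) \<longleftrightarrow> (b = Suc a \<or> a = Suc b) \<and> a \<le> N \<and> b \<le> N"
| "edge N (Corridor a) (Trail i) \<longleftrightarrow> a \<le> N \<and> i \<le> N \<and> gap N i a = 0"
| "edge N (Corridor a) (Ring k) \<longleftrightarrow> a \<le> N \<and> k < 3"
| "edge N (Trail i) (Trail j) \<longleftrightarrow> j = Suc i \<and> j \<le> N"
| "edge N (Trail i) (Ring k) \<longleftrightarrow> i \<le> N \<and> k = i mod 2"
| "edge N (Ring k) (Ring l) \<longleftrightarrow> k < 3 \<and> l = Suc k mod 3"
| "edge N _ _ \<longleftrightarrow> False"

definition nodes :: "nat \<Rightarrow> node set" where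
  "nodes N = Corridor ` {..N} \<union> Trail ` {..N} \<union> Ring ` {..<3}"

text \<open>Nodes are coded by \<open>to_nat\<close> because the family in the theorem lives on
  \<open>nat\<close>; each arc is its own pair of ends, so there are no parallel arcs.\<close>

definition G :: "nat \<Rightarrow> (nat, nat \<times> nat) pre_digraph" where
  "G N = \<lparr>verts = to_nat ` nodes N,
          arcs = {(to_nat x, to_nat y) | x y. edge N x y},
          tail = fst, head = snd\<rparr>"

lemma in_nodes [simp]:
  "Corridor a \<in> nodes N \<longleftrightarrow> a \<le> N"
  "Trail i \<in> nodes N \<longleftrightarrow> i \<le> N"
  "Ring k \<in> nodes N \<longleftrightarrow> k < 3"
  by (auto simp: nodes_def)

lemma finite_nodes: "finite (nodes N)"
  by (simp add: nodes_def)

lemma card_nodes: "card (nodes N) = 2 * N + 5"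
proof -
  have "card (nodes N) = card (Corridor ` {..N}) + card (Trail ` {..N}) + card (Ring ` {..<3})"
    unfolding nodes_def by (subst card_Un_disjoint; (subst card_Un_disjoint)?) auto
  also have "\<dots> = 2 * N + 5"
    by (simp add: card_image inj_on_def)
  finally show ?thesis .
qed

lemma card_verts_G: "card (verts (G N)) = 2 * N + 5"
  by (simp add: G_def card_image card_nodes)

lemma edge_nodes: "edge N x y \<Longrightarrow> x \<in> nodes N \<and> y \<in> nodes N"
  by (cases "(N, x, y)" rule: edge.cases) auto

lemma edge_irrefl: "\<not> edge N x x"
proof (cases x)
  case (Ring k)
  have "k \<noteq> Suc k mod 3" if "k < 3" using that by presburger
  then show ?thesis using Ring by auto
qed auto

lemma digraph_G: "digraph (G N)"
proof
  show "finite (verts (G N))" by (simp add: G_def finite_nodes)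
  have "arcs (G N) \<subseteq> verts (G N) \<times> verts (G N)"
    by (auto simp: G_def dest: edge_nodes)
  then show "finite (arcs (G N))"
    by (rule finite_subset) (simp add: G_def finite_nodes)
  show "tail (G N) e \<in> verts (G N)" "head (G N) e \<in> verts (G N)" if "e \<in> arcs (G N)" for e
    using that by (auto simp: G_def dest: edge_nodes)
  show "tail (G N) e \<noteq> head (G N) e" if "e \<in> arcs (G N)" for e
    using that by (auto simp: G_def edge_irrefl)
  show "e = f" if "e \<in> arcs (G N)" "f \<in> arcs (G N)" "arc_to_ends (G N) e = arc_to_ends (G N) f"
    for e f
    using that by (auto simp: G_def arc_to_ends_def)
qed

definition step :: "nat \<Rightarrow> node \<Rightarrow> node \<Rightarrow> bool" where
  "step N x y \<longleftrightarrow> x = y \<or> edge N x y"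

lemma move_G: "move (G N) (to_nat x) v \<longleftrightarrow> (\<exists>y. v = to_nat y \<and> step N x y)"
  by (auto simp: move_def step_def G_def arcs_ends_def arc_to_ends_def image_iff)

section \<open>The cop wins\<close>

text \<open>A rank that falls in every round until capture. Each trail vertex still ahead is worth
  \<open>N + 1\<close>, more than any gap. A robber in the corridor ranks above all trail positions,
  and \<open>N - a\<close> measures the rest of the cop's sweep. Against a robber on the ring the
  rank is 0, as capture is immediate.\<close>

fun chase_bound :: "nat \<Rightarrow> node \<Rightarrow> node \<Rightarrow> nat" where
  "chase_bound N (Corridor a) (Corridor b) = (N + 1) * (N + 1) + (N - a)"
| "chase_bound N (Corridor a) (Trail i) = (N - i) * (N + 1) + gap N i a"
| "chase_bound N _ _ = 0"

text \<open>The cop sweeps from \<open>Corridor 0\<close>, so a robber in the corridor is always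
  ahead of him and cannot get past.\<close>

fun chase :: "nat \<Rightarrow> node \<Rightarrow> node \<Rightarrow> bool" where
  "chase N (Corridor a) (Corridor b) \<longleftrightarrow> a < b \<and> b \<le> N"
| "chase N (Corridor a) (Trail i) \<longleftrightarrow> a \<le> N \<and> i \<le> N"
| "chase N (Corridor a) (Ring k) \<longleftrightarrow> a \<le> N \<and> k < 3"
| "chase N _ _ \<longleftrightarrow> False"

lemma gap_le: "a \<le> N \<Longrightarrow> gap N i a \<le> N"
  by (simp add: gap_def)

lemma approach:
  assumes "a \<le> N" "gap N i a = Suc d"
  shows "\<exists>b\<le>N. edge N (Corridor a) (Corridor b) \<and> gap N i b = d"
proof (cases "even i")
  case True
  then show ?thesis using assms by (intro exI[of _ "a - 1"]) (auto simp: gap_def)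
next
  case False
  then show ?thesis using assms by (intro exI[of _ "Suc a"]) (auto simp: gap_def)
qed

lemma trail_bound: "a \<le> N \<Longrightarrow> chase_bound N (Corridor a) (Trail i) < (N + 1) * (N + 1)"
proof -
  assume a: "a \<le> N"
  have "(N - i) * (N + 1) + gap N i a \<le> N * (N + 1) + N"
    using gap_le[OF a] by (intro add_mono mult_right_mono) auto
  then show ?thesis by simp
qed

text \<open>The cop sweeps towards \<open>N\<close> while the robber is in the corridor, walks to
  the threatening end once he is on the trail, and captures him at once on the ring.\<close>

lemma chase_step:
  assumes "chase N x r"
  shows "\<exists>x'. step N x x' \<and> (x' = r \<or> (\<forall>r'. step N r r' \<longrightarrow> r' = x' \<or>
    chase N x' r' \<and> chase_bound N x' r' < chase_bound N x r))"
proof (cases "(N, x, r)" rule: chase.cases)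
  case (1 _ a b)
  then have x: "x = Corridor a" "r = Corridor b" "a < b" "b \<le> N" using assms by auto
  have "chase N (Corridor (Suc a)) r' \<and>
      chase_bound N (Corridor (Suc a)) r' < chase_bound N x r"
    if "step N r r'" "r' \<noteq> Corridor (Suc a)" "r \<noteq> Corridor (Suc a)" for r'
  proof (cases r')
    case (Corridor c)
    then show ?thesis using that x by (auto simp: step_def)
  next
    case (Trail i)
    then show ?thesis using that x trail_bound[of "Suc a" N i]
      by (auto simp: step_def)
  next
    case (Ring k)
    then show ?thesis using that x by (auto simp: step_def)
  qed
  moreover have "step N x (Corridor (Suc a))" using x by (auto simp: step_def)
  ultimately show ?thesis
    by (intro exI[of _ "Corridor (Suc a)"] conjI) blast+
next
  case (2 _ a i)
  then have x: "x = Corridor a" "r = Trail i" "a \<le> N" "i \<le> N" using assms by auto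
  show ?thesis
  proof (cases "gap N i a")
    case 0
    then have "step N x r" using x by (simp add: step_def)
    then show ?thesis by blast
  next
    case (Suc d)
    obtain b where b: "b \<le> N" "edge N (Corridor a) (Corridor b)" "gap N i b = d"
      using approach[OF x(3) Suc] by blast
    have "chase N (Corridor b) r' \<and> chase_bound N (Corridor b) r' < chase_bound N x r"
      if "step N r r'" for r'
    proof (cases r')
      case (Corridor c)
      then show ?thesis using that x by (auto simp: step_def)
    next
      case (Trail j)
      have "j = i \<or> j = Suc i \<and> j \<le> N" using that x Trail by (auto simp: step_def)
      then show ?thesis
      proof (elim disjE conjE)
        assume 1: "j = i"
        then show ?thesis using b x Trail Suc by simp
      next
        \<comment> \<open>Advancing gives up a block of \<open>N + 1\<close>, which outweighs the
          new gap of at most \<open>N\<close>.\<close>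
        assume 2: "j = Suc i" "j \<le> N"
        then have "N - i = Suc (N - j)" by simp
        then show ?thesis using 2 b x Trail Suc gap_le[OF b(1), of j] by simp
      qed
    next
      case (Ring k)
      then show ?thesis using that x b Suc by (auto simp: step_def)
    qed
    moreover have "step N x (Corridor b)" using b x by (simp add: step_def)
    ultimately show ?thesis
      by (intro exI[of _ "Corridor b"] conjI) blast+
  qed
next
  case (3 _ a k)
  then have "step N x r" using assms by (simp add: step_def)
  then show ?thesis by blast
qed (use assms in auto)

text \<open>The starting rank is at most \<open>(N + 1) * (N + 1) + N\<close>, attained against a
  robber in the corridor; the strict inequality in \<open>J\<close> adds one.\<close>

lemma cop_wins_G: "cops_win_within (G N) 1 ((N + 1) * (N + 1) + N + 1)"
proof (rule cops_win_within_oneI[where start = "to_nat (Corridor 0)" and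
      J = "\<lambda>n u v. \<exists>x r. u = to_nat x \<and> v = to_nat r \<and> chase N x r \<and> chase_bound N x r < n"])
  show "to_nat (Corridor 0) \<in> verts (G N)" by (simp add: G_def)
next
  fix v assume "v \<in> verts (G N)"
  then obtain r where r: "v = to_nat r" "r \<in> nodes N" by (auto simp: G_def)
  have "r = Corridor 0 \<or> chase N (Corridor 0) r \<and>
      chase_bound N (Corridor 0) r < (N + 1) * (N + 1) + N + 1"
  proof (cases r)
    case (Trail i)
    have "chase_bound N (Corridor 0) r < (N + 1) * (N + 1)"
      unfolding Trail by (rule trail_bound) simp
    then show ?thesis using r(2) Trail by simp
  qed (use r(2) in auto)
  then show "v = to_nat (Corridor 0) \<or> (\<exists>x r. to_nat (Corridor 0) = to_nat x \<and>
      v = to_nat r \<and> chase N x r \<and> chase_bound N x r < (N + 1) * (N + 1) + N + 1)"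
    using r(1) by blast
next
  fix n u v
  assume "\<exists>x r. u = to_nat x \<and> v = to_nat r \<and> chase N x r \<and> chase_bound N x r < Suc n"
  then obtain x r where x: "u = to_nat x" "v = to_nat r" "chase N x r" "chase_bound N x r \<le> n"
    by auto
  obtain x' where x': "step N x x'" "x' = r \<or> (\<forall>r'. step N r r' \<longrightarrow> r' = x' \<or>
      chase N x' r' \<and> chase_bound N x' r' < chase_bound N x r)"
    using chase_step[OF x(3)] by blast
  have "move (G N) u (to_nat x')" using x x' by (auto simp: move_G)
  moreover have "to_nat x' = v \<or> (\<forall>v'. move (G N) v v' \<longrightarrow> v' = to_nat x' \<or>
      (\<exists>y r. to_nat x' = to_nat y \<and> v' = to_nat r \<and> chase N y r \<and> chase_bound N y r < n))"
    using x' x less_le_trans unfolding x(2) move_G by blast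
  ultimately show "\<exists>x'. move (G N) u x' \<and> (x' = v \<or> (\<forall>r'. move (G N) v r' \<longrightarrow> r' = x' \<or>
      (\<exists>x r. x' = to_nat x \<and> r' = to_nat r \<and> chase N x r \<and> chase_bound N x r < n)))"
    by blast
qed simp

section \<open>The robber survives for quadratically many rounds\<close>

fun off_corridor :: "node \<Rightarrow> bool" where
  "off_corridor (Corridor _) \<longleftrightarrow> False"
| "off_corridor _ \<longleftrightarrow> True"

text \<open>Arcs between the corridor and the rest all lead out of the corridor, so leaving it is
  irrevocable.\<close>

lemma off_corridor_step: "step N x y \<Longrightarrow> off_corridor x \<Longrightarrow> off_corridor y"
  by (cases "(N, x, y)" rule: edge.cases) (auto simp: step_def)

lemma step_nodes: "step N x y \<Longrightarrow> x \<in> nodes N \<Longrightarrow> y \<in> nodes N"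
  by (auto simp: step_def dest: edge_nodes)

lemma ring_succ: "k < 3 \<Longrightarrow> Suc k mod 3 \<noteq> k \<and> Suc (Suc k mod 3) mod 3 \<noteq> Suc k mod 3
    \<and> Suc (Suc k mod 3) mod 3 \<noteq> k"
  for k :: nat by (simp add: mod_Suc)

lemma parity_exit: "Suc (i mod 2) mod 3 \<noteq> i mod 2 \<and> Suc i mod 2 \<noteq> i mod 2"
  for i :: nat by (cases "i mod 2 = 0") (simp_all add: mod_Suc)

text \<open>
  Once the cop has left the corridor, the robber can always restore the invariant that he is
  outside the closed out-neighbourhood of the cop.
\<close>
lemma escape:
  assumes "x \<in> nodes N" "r \<in> nodes N" "off_corridor x" "off_corridor r" "x \<noteq> r"
  shows "\<exists>r'. step N r r' \<and> \<not> step N x r'"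
proof (cases "step N x r")
  case False
  then show ?thesis by (auto simp: step_def)
next
  case True
  then have e: "edge N x r" using assms by (simp add: step_def)
  show ?thesis
  \<comment> \<open>Threatened on the trail, the robber takes his own exit, whose parity differs
    from the cop's. Threatened on the ring, he advances by one, out of reach from the trail and from
    the preceding ring vertex.\<close>
  proof (cases "(N, x, r)" rule: edge.cases)
    case (4 _ i j)
    with e assms have "step N r (Ring (j mod 2))" "\<not> step N x (Ring (j mod 2))"
      using parity_exit[of i] by (auto simp: step_def)
    then show ?thesis by blast
  next
    case (5 _ i k)
    with e assms have "step N r (Ring (Suc k mod 3))" "\<not> step N x (Ring (Suc k mod 3))"
      using parity_exit[of i] by (auto simp: step_def)
    then show ?thesis by blast
  next
    case (6 _ k l)
    with e assms have "step N r (Ring (Suc l mod 3))" "\<not> step N x (Ring (Suc l mod 3))"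
      using ring_succ[of k] by (auto simp: step_def)
    then show ?thesis by blast
  qed (use e assms in auto)
qed

text \<open>The trail dominates only \<open>Ring 0\<close> and \<open>Ring 1\<close> on the ring,
  and no arc leads from the ring back to the trail.\<close>

lemma safe_start:
  assumes "x \<in> nodes N" "off_corridor x"
  shows "\<exists>r\<in>nodes N. off_corridor r \<and> \<not> step N x r"
proof (cases x)
  case (Trail i)
  have "i mod 2 < 2" by simp
  then have "\<not> step N x (Ring 2)" using Trail by (auto simp: step_def)
  then show ?thesis by (intro bexI[of _ "Ring 2"]) simp_all
next
  case (Ring k)
  then have "\<not> step N x (Trail 0)" by (simp add: step_def)
  then show ?thesis by (intro bexI[of _ "Trail 0"]) simp_all
qed (use assms in auto)

text \<open>\<open>n\<close> is the number of rounds still to survive. Against a cop on the corridor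
  each trail vertex ahead is worth \<open>N\<close> rounds, one traversal. Off the corridor the
  robber survives for ever, so \<open>n\<close> is unrestricted there.\<close>

definition evading :: "nat \<Rightarrow> nat \<Rightarrow> node \<Rightarrow> node \<Rightarrow> bool" where
  "evading N n x r \<longleftrightarrow> x \<in> nodes N \<and> r \<in> nodes N \<and> off_corridor r \<and> \<not> step N x r \<and>
    (\<forall>a. x = Corridor a \<longrightarrow> (\<exists>i. r = Trail i \<and> n < (N - i) * N + gap N i a))"

lemma evading_start:
  assumes "x \<in> nodes N" "0 < N" "n < N * N"
  shows "\<exists>r\<in>nodes N. evading N n x r"
proof (cases x)
  case (Corridor a)
  show ?thesis
  proof (cases "a = 0")
    case True
    \<comment> \<open>End \<open>0\<close> dominates \<open>Trail 0\<close>, so the robber starts at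
      \<open>Trail 1\<close>; the block this costs is made up by the full gap
      \<open>N\<close>.\<close>
    have "n < (N - 1) * N + N" using assms by (cases N) auto
    then have "evading N n x (Trail 1)"
      using assms Corridor True by (auto simp: evading_def step_def gap_def)
    then show ?thesis using assms by (intro bexI[of _ "Trail 1"]) simp_all
  next
    case False
    then have "evading N n x (Trail 0)"
      using assms Corridor by (auto simp: evading_def step_def gap_def)
    then show ?thesis by (intro bexI[of _ "Trail 0"]) simp_all
  qed
qed (use assms safe_start[OF assms(1)] in \<open>fastforce simp: evading_def\<close>)+

text \<open>A step along the corridor shrinks the gap by at most one. The robber waits while the gap
  is positive and advances when it reaches 0, exchanging one block for a fresh gap
  \<open>N\<close>.\<close>

lemma evading_step:
  assumes ev: "evading N (Suc n) x r" and x': "step N x x'" and N: "0 < N"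
  shows "x' \<noteq> r \<and> (\<exists>r'. step N r r' \<and> evading N n x' r')"
proof
  have x: "x \<in> nodes N" and r: "r \<in> nodes N" "off_corridor r" and free: "\<not> step N x r"
    and pot: "\<And>a. x = Corridor a \<Longrightarrow> \<exists>i. r = Trail i \<and> Suc n < (N - i) * N + gap N i a"
    using ev by (simp_all add: evading_def)
  show ne: "x' \<noteq> r" using free x' by metis
  have x'_in: "x' \<in> nodes N" by (rule step_nodes[OF x' x])
  show "\<exists>r'. step N r r' \<and> evading N n x' r'"
  proof (cases "off_corridor x'")
    case True
    obtain r' where r': "step N r r'" "\<not> step N x' r'"
      using escape[OF x'_in r(1) True r(2) ne] by blast
    have "x' \<noteq> Corridor b" for b using True by auto
    then have "evading N n x' r'"
      using x'_in r' step_nodes[OF r'(1) r(1)] off_corridor_step[OF r'(1) r(2)]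
      by (simp add: evading_def)
    then show ?thesis using r' by blast
  next
    case False
    then obtain b where b: "x' = Corridor b" by (cases x') auto
    obtain a where a: "x = Corridor a"
      using off_corridor_step[OF x'] False by (cases x) auto
    obtain i where i: "r = Trail i" "Suc n < (N - i) * N + gap N i a" "i \<le> N"
      using pot[OF a] r(1) by auto
    have ab: "a \<le> N" "b \<le> N" using x x'_in a b by auto
    have gap: "gap N i a \<le> Suc (gap N i b)"
      using x' a b by (auto simp: step_def gap_def)
    show ?thesis
    proof (cases "gap N i b")
      case 0
      then have "gap N i a = 1" using free a i ab gap by (auto simp: step_def)
      \<comment> \<open>At \<open>i = N\<close> the budget would be the gap 1 alone, which cannot
        exceed \<open>Suc n\<close>.\<close>
      then have "i < N" using i by (cases "i = N") auto
      then have *: "N - i = Suc (N - Suc i)" by simp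
      \<comment> \<open>Parity switches the threatening end, and the cop stands at the opposite one.
        The budget drops from \<open>(N - i) * N + 1\<close> to \<open>(N - i) * N\<close>, by
        exactly one.\<close>
      have "gap N (Suc i) b = N" using 0 ab by (auto simp: gap_def split: if_splits)
      then have "evading N n x' (Trail (Suc i))"
        using i b ab N \<open>i < N\<close> \<open>gap N i a = 1\<close> *
        by (auto simp: evading_def step_def)
      moreover have "step N r (Trail (Suc i))" using i \<open>i < N\<close> by (simp add: step_def)
      ultimately show ?thesis by blast
    next
      case (Suc d)
      then have "evading N n x' r"
        using i b ab gap by (auto simp: evading_def step_def)
      then show ?thesis by (auto simp: step_def)
    qed
  qed
qed

lemma robber_survives_G:
  assumes "0 < N" "T < N * N"
  shows "\<not> cops_win_within (G N) 1 T"
proof (rule not_cops_win_within_oneI[where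
      I = "\<lambda>n u v. \<exists>x r. u = to_nat x \<and> v = to_nat r \<and> evading N n x r"])
  fix u assume "u \<in> verts (G N)"
  then obtain x where "u = to_nat x" "x \<in> nodes N" by (auto simp: G_def)
  then show "\<exists>v\<in>verts (G N). \<exists>x r. u = to_nat x \<and> v = to_nat r \<and> evading N T x r"
    using evading_start[of x N T] assms by (auto simp: G_def)
next
  fix n :: nat and u v :: nat
  assume "\<exists>x r. u = to_nat x \<and> v = to_nat r \<and> evading N n x r"
  then show "u \<noteq> v" by (auto simp: evading_def step_def)
next
  fix n u u' v
  assume "\<exists>x r. u = to_nat x \<and> v = to_nat r \<and> evading N (Suc n) x r" and mv: "move (G N) u u'"
  then obtain x r where x: "u = to_nat x" "v = to_nat r" "evading N (Suc n) x r" by blast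
  obtain x' where x': "u' = to_nat x'" "step N x x'" using mv x(1) by (auto simp: move_G)
  show "u' \<noteq> v \<and> (\<exists>v'. move (G N) v v' \<and>
      (\<exists>x r. u' = to_nat x \<and> v' = to_nat r \<and> evading N n x r))"
    using evading_step[OF x(3) x'(2) assms(1)] x x'(1) by (auto simp: move_G)
qed

section \<open>Cop number, capture time and the constants\<close>

lemma cop_number_G: "cop_number (G N) = 1"
  unfolding cop_number_def
proof (rule Least_equality)
  show "cops_win (G N) 1"
    using cop_wins_G[of N] unfolding cops_win_def cops_win_within_def by blast
  have "verts (G N) \<noteq> {}" using card_verts_G[of N] by auto
  then show "1 \<le> k" if "cops_win (G N) k" for k
    using that not_cops_win_zero[of "G N"] by (cases k) auto
qed

lemma capture_time_G_le: "capture_time (G N) \<le> (N + 1) * (N + 1) + N + 1"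
  unfolding capture_time_def cop_number_G by (rule Least_le) (rule cop_wins_G)

lemma capture_time_G_ge:
  assumes "0 < N"
  shows "N * N \<le> capture_time (G N)"
proof (rule ccontr)
  assume "\<not> N * N \<le> capture_time (G N)"
  then have "\<not> cops_win_within (G N) 1 (capture_time (G N))"
    using robber_survives_G assms by simp
  moreover have "cops_win_within (G N) 1 (capture_time (G N))"
    unfolding capture_time_def cop_number_G by (rule LeastI) (rule cop_wins_G)
  ultimately show False by contradiction
qed

theorem theorem26:
  shows "\<exists>(a::real) (b::real) (F :: (nat, nat \<times> nat) pre_digraph set).
    0 < a \<and> a \<le> b \<and> infinite F \<and>
    (\<forall>N. \<exists>D\<in>F. N \<le> card (verts D)) \<and>
    (\<forall>D\<in>F. digraph D \<and> cop_number D = 1 \<and>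
       a * real (card (verts D)) ^ 2 \<le> real (capture_time D) \<and>
       real (capture_time D) \<le> b * real (card (verts D)) ^ 2)"
proof -
  \<comment> \<open>From \<open>N = 5\<close> on, \<open>2 * N + 5\<close> is at most
    \<open>3 * N\<close>, so \<open>N * N\<close> is at least a ninth of the squared order: hence
    the constant \<open>1/9\<close>.\<close>
  let ?F = "G ` {5..}"
  have large: "\<exists>D\<in>?F. N \<le> card (verts D)" for N
    by (rule bexI[of _ "G (N + 5)"]) (auto simp: card_verts_G)
  \<comment> \<open>A finite family would have a largest order.\<close>
  have "infinite ?F"
  proof
    assume fin: "finite ?F"
    obtain D where D: "D \<in> ?F" "Suc (Max ((\<lambda>D. card (verts D)) ` ?F)) \<le> card (verts D)"
      using large by blast
    then have "card (verts D) \<le> Max ((\<lambda>D. card (verts D)) ` ?F)"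
      using fin by (intro Max_ge) auto
    then show False using D(2) by simp
  qed
  moreover have "1/9 * real (card (verts (G N))) ^ 2 \<le> real (capture_time (G N)) \<and>
      real (capture_time (G N)) \<le> 1 * real (card (verts (G N))) ^ 2" if "5 \<le> N" for N
  proof
    have "real (2 * N + 5) ^ 2 \<le> (3 * real N) ^ 2"
      using that by (intro power_mono) auto
    also have "\<dots> = 9 * real (N * N)" by (simp add: power2_eq_square)
    also have "\<dots> \<le> 9 * real (capture_time (G N))"
      using capture_time_G_ge[of N] that by (simp only: mult_le_cancel_left_pos of_nat_le_iff)
    finally show "1/9 * real (card (verts (G N))) ^ 2 \<le> real (capture_time (G N))"
      by (simp add: card_verts_G)
    \<comment> \<open>The upper bound \<open>(N + 1) * (N + 1) + N + 1\<close> already lies below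
      the squared order, so the second constant is 1.\<close>
    have "capture_time (G N) \<le> (2 * N + 5) ^ 2"
      by (rule order_trans[OF capture_time_G_le]) (simp add: power2_eq_square algebra_simps)
    then show "real (capture_time (G N)) \<le> 1 * real (card (verts (G N))) ^ 2"
      unfolding card_verts_G by (metis mult_1 of_nat_le_iff of_nat_power)
  qed
  ultimately show ?thesis
    using large
    by (intro exI[of _ "1/9"] exI[of _ 1] exI[of _ ?F])
      (auto simp: digraph_G cop_number_G)
qed

end
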